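(* Let $p$ be an odd prime, and let $d=\deg(P)$. Then: (a) if $\Delta$ is a non-zero quadratic residue modulo $P$, then $\alpha(P)\mid q^d-1$ and $\pi(P)\mid q^d-1$; (b) if $\Delta$ is a quadratic non-residue modulo $P$, then $\alpha(P)\mid q^d+1$ and $\pi(P)\mid (q^d+1)\,\mathrm{ord}_P(-b)$; (c) if $\Delta\equiv 0\pmod P$, then $\alpha(P)=p$ and $\pi(P)=p\cdot\mathrm{ord}_P(2^{-1}a)$.
   Context: Let $\mathbb{F}_q$ be the finite field with $q=p^l$ elements, $p$ prime, $l\ge1$. Fix $a,b\in\mathbb{F}_q[x]$ with $b\neq 0$, and put $\Delta=a^2+4b$. The generalized Fibonacci sequence is $F_0=0$, $F_1=1$, $F_n=aF_{n-1}+bF_{n-2}$ for $n\ge 2$. Let $P\in\mathbb{F}_q[x]$ be an irreducible polynomial with $\gcd(b,P)=1$. The rank $\alpha(P)$ is the least positive integer $n$ with $F_n\equiv 0\pmod P$, and the period $\pi(P)$ is the least positive integer $n$ with $F_n\equiv 0$ and $F_{n+1}\equiv 1\pmod P$. For $g$ coprime to $P$, $\mathrm{ord}_P(g)$ is the multiplicative order of $g$ modulo $P$. *)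

theory Defs
  imports "HOL-Computational_Algebra.Computational_Algebra" "HOL-Number_Theory.Cong" "HOL-Library.Cardinality"
begin

fun gen_fib :: "'a::field poly \<Rightarrow> 'a poly \<Rightarrow> nat \<Rightarrow> 'a poly" where
  "gen_fib a b 0 = 0"
| "gen_fib a b (Suc 0) = 1"
| "gen_fib a b (Suc (Suc n)) = a * gen_fib a b (Suc n) + b * gen_fib a b n"

definition fib_disc :: "'a::field poly \<Rightarrow> 'a poly \<Rightarrow> 'a poly" where
  "fib_disc a b = a\<^sup>2 + 4 * b"

text \<open>
  The three least positive integers below exist when the coefficient field is finite, \<open>P\<close> is
  irreducible, and \<open>b\<close> (respectively \<open>g\<close>) is coprime to \<open>P\<close>; they are used only in that situation.
\<close>

definition fib_rank :: "'a::field poly \<Rightarrow> 'a poly \<Rightarrow> 'a poly \<Rightarrow> nat" where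
  "fib_rank a b P = (LEAST n. n > 0 \<and> [gen_fib a b n = 0] (mod P))"

definition fib_period :: "'a::field poly \<Rightarrow> 'a poly \<Rightarrow> 'a poly \<Rightarrow> nat" where
  "fib_period a b P =
     (LEAST n. n > 0 \<and> [gen_fib a b n = 0] (mod P) \<and> [gen_fib a b (n + 1) = 1] (mod P))"

definition poly_ord :: "'a::field poly \<Rightarrow> 'a poly \<Rightarrow> nat" where
  "poly_ord P g = (LEAST n. n > 0 \<and> [g ^ n = 1] (mod P))"

text \<open>
  As with \<open>QuadRes\<close> in \<open>HOL-Number_Theory\<close>, \<open>0\<close> counts as a quadratic residue here, so the negation
  of this predicate is the usual notion of a quadratic non-residue.
\<close>

definition poly_QuadRes :: "'a::field poly \<Rightarrow> 'a poly \<Rightarrow> bool" where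
  "poly_QuadRes P g \<longleftrightarrow> (\<exists>y. [y\<^sup>2 = g] (mod P))"

end

theory Submission
  imports Defs
begin

text \<open>
  Let \<open>\<Delta>\<close> be the discriminant, \<open>p\<close> the characteristic of the coefficient field and \<open>Q = q\<^sup>d\<close> the size
  of the residue field modulo \<open>P\<close>. The terms of the sequence are the coordinates of the powers of \<open>t\<close>
  modulo the characteristic polynomial \<open>t\<^sup>2 - a t - b\<close>, and \<open>2 t - a\<close> is a square root of \<open>\<Delta>\<close> there.
  Raising \<open>2 t = (2 t - a) + a\<close> to the odd power \<open>m = p\<^sup>k\<close>, an additive operation, therefore gives
  the exact identities
  \<open>F\<^sub>m = \<Delta>\<^bsup>(m-1)/2\<^esup>\<close> and \<open>2 b F\<^bsub>m-1\<^esub> = a\<^sup>m - a \<Delta>\<^bsup>(m-1)/2\<^esup>\<close>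
  (lemma \<open>gen_fib_CHAR_power\<close>).

  For \<open>m = Q\<close>, Fermat's theorem modulo \<open>P\<close> replaces \<open>a\<^sup>Q\<close> by \<open>a\<close>, and the power of \<open>\<Delta>\<close> is its quadratic
  character. If \<open>\<Delta>\<close> is a nonzero square, this is \<open>1\<close>, so \<open>F\<^bsub>Q-1\<^esub> \<equiv> 0\<close> and \<open>F\<^sub>Q \<equiv> 1\<close>: the sequence has
  returned to its start at \<open>Q - 1\<close>. If \<open>\<Delta>\<close> is a nonsquare, it is \<open>- 1\<close> by Euler's criterion
  (\<open>poly_euler_criterion_nonresidue\<close>), so \<open>F\<^bsub>Q+1\<^esub> \<equiv> 0\<close> and \<open>F\<^bsub>Q+2\<^esub> \<equiv> - b\<close>: at \<open>Q + 1\<close> the sequence restarts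
  with the factor \<open>- b\<close>, and it has returned once this factor has been applied as often as its order.
  That the rank and the period divide the indices found in this way is a division with remainder
  (\<open>least_positive_period_dvd\<close>).

  If \<open>\<Delta> \<equiv> 0\<close>, the characteristic polynomial has the double root \<open>r = a / 2\<close>, and \<open>F\<^sub>n \<equiv> n r\<^bsup>n-1\<^esup>\<close>
  (\<open>gen_fib_double_root_cong\<close>) determines rank and period exactly.
\<close>

section \<open>Least positive periods\<close>

text \<open>
Rank and period are both least positive elements of a set of indices that is invariant under
shifting by any of its own members. Division with remainder by the least member then leaves a
smaller member, which has to be \<open>0\<close>.
\<close>

lemma least_positive_period_dvd:
  fixes S :: "nat \<Rightarrow> bool"
  assumes shift: "\<And>m k. S m \<Longrightarrow> S (m + k) \<longleftrightarrow> S k"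
    and "S n"
  shows "(LEAST m. m > 0 \<and> S m) dvd n"
proof (cases "n = 0")
  case False
  define m where "m = (LEAST m. m > 0 \<and> S m)"
  have "m > 0 \<and> S m"
    unfolding m_def by (rule LeastI[of _ n]) (use False assms in auto)
  have multiples: "S (m * j + k) \<longleftrightarrow> S k" for j k
    by (induction j) (use shift \<open>m > 0 \<and> S m\<close> in \<open>auto simp: add.assoc\<close>)
  have "S (n mod m)"
    using multiples[of "n div m" "n mod m"] \<open>S n\<close> by simp
  moreover have "n mod m < m"
    using \<open>m > 0 \<and> S m\<close> by simp
  ultimately have "n mod m = 0"
    using not_less_Least[of "n mod m" "\<lambda>m. m > 0 \<and> S m"] by (auto simp: m_def)
  then show ?thesis
    by (auto simp: m_def)
qed simp

text \<open>
This turns the period in the case of zero discriminant, which is sought among the multiples of the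
characteristic, into the characteristic times a multiplicative order.
\<close>

lemma LEAST_positive_multiple:
  fixes p :: nat
  assumes "p > 0" and ex: "n > 0" "S n"
  shows "(LEAST n. n > 0 \<and> p dvd n \<and> S (n div p)) = p * (LEAST n. n > 0 \<and> S n)"
proof (rule Least_equality)
  have "(LEAST n. n > 0 \<and> S n) > 0 \<and> S (LEAST n. n > 0 \<and> S n)"
    using LeastI[of "\<lambda>n. n > 0 \<and> S n" n] ex by blast
  then show "p * (LEAST n. n > 0 \<and> S n) > 0 \<and> p dvd p * (LEAST n. n > 0 \<and> S n) \<and>
      S (p * (LEAST n. n > 0 \<and> S n) div p)"
    using assms(1) by auto
next
  fix y assume y: "y > 0 \<and> p dvd y \<and> S (y div p)"
  then have "(LEAST n. n > 0 \<and> S n) \<le> y div p"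
    by (intro Least_le) (auto elim!: dvdE)
  then show "p * (LEAST n. n > 0 \<and> S n) \<le> y"
    using y by (metis dvd_mult_div_cancel mult_le_mono2)
qed

section \<open>Prime characteristic\<close>

text \<open>
Translation by \<open>1\<close> permutes the ring, so the sum of all elements does not change when \<open>1\<close> is
added to each of them.
\<close>

lemma of_nat_CARD_eq_0: "of_nat CARD('a::{ring_1,finite}) = (0 :: 'a)"
proof -
  have "(\<Sum>x\<in>(UNIV :: 'a set). x) = (\<Sum>x\<in>UNIV. x + 1)"
    by (rule sum.reindex_bij_witness[of _ "\<lambda>x. x + 1" "\<lambda>x. x - 1"]) auto
  then show ?thesis
    by (simp add: sum.distrib)
qed

lemma CHAR_power_odd:
  assumes "prime CHAR('a::semiring_1)" and "CHAR('a) \<noteq> 2"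
  shows "odd (CHAR('a) ^ k)"
  using assms primes_dvd_imp_eq[OF two_is_prime_nat assms(1)] by auto

lemma two_power_CHAR_power:
  assumes "prime CHAR('a::comm_semiring_1)"
  shows "(2 :: 'a) ^ (CHAR('a) ^ k) = 2"
  using freshmans_dream'[OF assms refl, of 1 1 k] by simp

lemma CHAR_eq_of_CARD_prime_power:
  assumes "prime p" and "CARD('a::finite_field) = p ^ l"
  shows "CHAR('a) = p"
proof -
  have "CHAR('a) dvd p ^ l"
    using of_nat_CARD_eq_0[where ?'a = 'a] of_nat_eq_0_iff_char_dvd[where ?'a = 'a] assms(2)
    by metis
  then have "CHAR('a) dvd p"
    using CHAR_prime prime_dvd_power by blast
  then show ?thesis
    using assms(1) CHAR_prime primes_dvd_imp_eq by blast
qed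

section \<open>Residues modulo an irreducible polynomial\<close>

lemma irreducible_poly_dvd_mult_iff:
  fixes P :: "'a::field poly"
  assumes "irreducible P"
  shows "P dvd f * g \<longleftrightarrow> P dvd f \<or> P dvd g"
  using field_poly_irreducible_imp_prime[OF assms] by (rule prime_elem_dvd_mult_iff)

lemma irreducible_poly_dvd_prod:
  fixes P :: "'a::field poly"
  assumes "irreducible P" and "finite A" and "P dvd prod f A"
  shows "\<exists>x\<in>A. P dvd f x"
  using assms(2,3)
  by (induction A rule: finite_induct)
    (use assms(1) in \<open>auto simp: irreducible_poly_dvd_mult_iff irreducible_def\<close>)

lemma irreducible_poly_dvd_power:
  fixes P :: "'a::field poly"
  assumes "irreducible P" and "P dvd f ^ n"
  shows "P dvd f"
  using field_poly_irreducible_imp_prime[OF assms(1)] assms(2) by (rule prime_elem_dvd_power)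

lemma cong_mult_lcancel_irreducible:
  fixes P :: "'a::field poly"
  assumes "irreducible P" and "\<not> P dvd k"
  shows "[k * f = k * g] (mod P) \<longleftrightarrow> [f = g] (mod P)"
  using assms by (simp add: cong_iff_dvd_diff irreducible_poly_dvd_mult_iff
      flip: right_diff_distrib)

lemma coprime_irreducible_not_dvd:
  fixes P :: "'a::field poly"
  assumes "irreducible P" and "coprime b P"
  shows "\<not> P dvd b"
  using assms by (meson coprime_common_divisor dvd_refl irreducible_def)

lemma irreducible_poly_degree_pos:
  fixes P :: "'a::field poly"
  assumes "irreducible P"
  shows "degree P > 0"
  using assms by (auto simp: irreducible_def is_unit_iff_degree)

text \<open>
Integers are constant polynomials, and an irreducible polynomial has positive degree, so it divides
a constant only if that constant is \<open>0\<close>.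
\<close>

lemma poly_of_nat_dvd_iff:
  fixes P :: "'a::field poly"
  assumes "irreducible P"
  shows "P dvd of_nat n \<longleftrightarrow> CHAR('a) dvd n"
proof
  assume dvd: "P dvd of_nat n"
  show "CHAR('a) dvd n"
  proof (rule ccontr)
    assume "\<not> CHAR('a) dvd n"
    then have "(of_nat n :: 'a poly) \<noteq> 0"
      by (simp add: of_nat_eq_0_iff_char_dvd)
    then show False
      using dvd_imp_degree_le[OF dvd] irreducible_poly_degree_pos[OF assms] by simp
  qed
next
  assume "CHAR('a) dvd n"
  then have "(of_nat n :: 'a poly) = 0"
    by (simp add: of_nat_eq_0_iff_char_dvd)
  then show "P dvd of_nat n" by simp
qed

text \<open>
The Frobenius map is injective modulo \<open>P\<close>: \<open>r\<^sup>p - 1 = (r - 1)\<^sup>p\<close> in characteristic \<open>p\<close>.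
\<close>

lemma cong_one_power_CHAR_iff:
  fixes P r :: "'a::field poly"
  assumes "irreducible P" and "prime CHAR('a)"
  shows "[r ^ CHAR('a) = 1] (mod P) \<longleftrightarrow> [r = 1] (mod P)"
proof
  assume "[r ^ CHAR('a) = 1] (mod P)"
  moreover have "r ^ CHAR('a) = (r - 1) ^ CHAR('a) + 1"
    using freshmans_dream[where ?'a = "'a poly", OF _ refl, of "r - 1" 1] assms(2)
    unfolding semiring_char_poly diff_add_cancel power_one by blast
  ultimately have "P dvd (r - 1) ^ CHAR('a)"
    by (simp add: cong_iff_dvd_diff)
  then show "[r = 1] (mod P)"
    using irreducible_poly_dvd_power[OF assms(1)] by (simp add: cong_iff_dvd_diff)
next
  assume "[r = 1] (mod P)"
  then show "[r ^ CHAR('a) = 1] (mod P)"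
    using cong_pow[of r 1 P "CHAR('a)"] by simp
qed

lemma poly_two_not_dvd:
  fixes P :: "'a::field_prime_char poly"
  assumes "irreducible P" and "CHAR('a) \<noteq> 2"
  shows "\<not> P dvd 2"
  using poly_of_nat_dvd_iff[OF assms(1), of 2] assms(2)
    primes_dvd_imp_eq[OF CHAR_prime[where ?'a = 'a] two_is_prime_nat] by auto

text \<open>
These are the canonical representatives of the units of the residue field modulo an irreducible
polynomial. Working with representatives keeps all of the arithmetic inside the polynomial ring.
\<close>

definition unit_residues :: "'a::field poly \<Rightarrow> 'a poly set" where
  "unit_residues P = {r. degree r < degree P} - {0}"

text \<open>
The bound on the degree is stated through the coefficients because the degree of the zero
polynomial is \<open>0\<close>, which would break the induction at \<open>n = 0\<close>.
\<close>

lemma finite_card_poly_degree_less: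
  "finite {r :: 'a::{zero,finite} poly. \<forall>i\<ge>n. coeff r i = 0} \<and>
   card {r :: 'a poly. \<forall>i\<ge>n. coeff r i = 0} = CARD('a) ^ n"
proof (induction n)
  case 0
  have "{r :: 'a poly. \<forall>i\<ge>0. coeff r i = 0} = {0}"
    by (auto simp: poly_eq_iff)
  then show ?case by simp
next
  case (Suc n)
  let ?A = "\<lambda>n. {r :: 'a poly. \<forall>i\<ge>n. coeff r i = 0}"
  have "?A (Suc n) = (\<lambda>(c, r). pCons c r) ` (UNIV \<times> ?A n)"
  proof (intro equalityI subsetI)
    fix r assume "r \<in> ?A (Suc n)"
    then show "r \<in> (\<lambda>(c, r). pCons c r) ` (UNIV \<times> ?A n)"
      by (cases r) (force simp: coeff_pCons split: nat.splits)
  qed (auto simp: coeff_pCons split: nat.splits)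
  moreover have "inj_on (\<lambda>(c, r). pCons c r) (UNIV \<times> ?A n)"
    by (auto simp: inj_on_def)
  ultimately show ?case
    using Suc by (simp add: card_image card_cartesian_product)
qed

lemma
  fixes P :: "'a::finite_field poly"
  assumes "irreducible P"
  shows finite_unit_residues: "finite (unit_residues P)"
    and card_unit_residues: "card (unit_residues P) = CARD('a) ^ degree P - 1"
proof -
  note pos = irreducible_poly_degree_pos[OF assms]
  have eq: "{r :: 'a poly. degree r < degree P} = {r. \<forall>i\<ge>degree P. coeff r i = 0}"
    using pos by (auto simp: coeff_eq_0 intro: degree_lessI)
  show "finite (unit_residues P)" "card (unit_residues P) = CARD('a) ^ degree P - 1"
    using finite_card_poly_degree_less[where ?'a = 'a, of "degree P"] pos
    by (auto simp: unit_residues_def eq)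
qed

lemma card_unit_residues_pos:
  fixes P :: "'a::finite_field poly"
  assumes "irreducible P"
  shows "CARD('a) ^ degree P - 1 > 0"
proof -
  have "(1 :: 'a poly) \<in> unit_residues P"
    using irreducible_poly_degree_pos[OF assms] by (simp add: unit_residues_def)
  then show ?thesis
    using card_unit_residues[OF assms] finite_unit_residues[OF assms]
    by (metis card_gt_0_iff empty_iff)
qed

lemma unit_residues_not_dvd:
  "r \<in> unit_residues P \<Longrightarrow> \<not> P dvd r"
  unfolding unit_residues_def using dvd_imp_degree_le[of P r] by auto

lemma mod_in_unit_residues:
  fixes P :: "'a::field poly"
  assumes "irreducible P" and "\<not> P dvd f"
  shows "f mod P \<in> unit_residues P"
  using assms degree_mod_less'[of P f] irreducible_poly_degree_pos[OF assms(1)]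
  by (cases "P = 0") (auto simp: unit_residues_def dvd_eq_mod_eq_0)

lemma unit_residues_cong_imp_eq:
  assumes "[r = s] (mod P)" and "r \<in> unit_residues P" and "s \<in> unit_residues P"
  shows "r = s"
  using assms by (simp add: cong_def unit_residues_def mod_poly_less)

text \<open>
Multiplication by \<open>g\<close> permutes the nonzero residues. Comparing the product of all of them
before and after, the common factor cancels and a power of \<open>g\<close> congruent to \<open>1\<close> remains.
\<close>

lemma poly_fermat:
  fixes P :: "'a::finite_field poly"
  assumes irr: "irreducible P" and g: "\<not> P dvd g"
  shows "[g ^ (CARD('a) ^ degree P - 1) = 1] (mod P)"
proof -
  let ?U = "unit_residues P"
  note fin = finite_unit_residues[OF irr]
  have inj: "inj_on (\<lambda>r. (g * r) mod P) ?U"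
  proof (rule inj_onI)
    fix r s assume rs: "r \<in> ?U" "s \<in> ?U" "(g * r) mod P = (g * s) mod P"
    then have "[g * r = g * s] (mod P)" by (simp add: cong_def)
    then have "[r = s] (mod P)"
      by (simp add: cong_mult_lcancel_irreducible[OF irr g])
    then show "r = s" by (rule unit_residues_cong_imp_eq) (use rs in auto)
  qed
  have "(\<lambda>r. (g * r) mod P) ` ?U \<subseteq> ?U"
    using g by (auto intro!: mod_in_unit_residues[OF irr]
        simp: irreducible_poly_dvd_mult_iff[OF irr] dest: unit_residues_not_dvd)
  then have img: "(\<lambda>r. (g * r) mod P) ` ?U = ?U"
    using inj fin by (simp add: endo_inj_surj)
  have "\<Prod>?U = (\<Prod>r\<in>?U. (g * r) mod P)"
    using prod.reindex[OF inj, of "\<lambda>x. x"] by (simp add: img)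
  also have "[(\<Prod>r\<in>?U. (g * r) mod P) = (\<Prod>r\<in>?U. g * r)] (mod P)"
    by (rule cong_prod) simp
  also have "(\<Prod>r\<in>?U. g * r) = \<Prod>?U * g ^ card ?U"
    by (simp add: prod.distrib)
  finally have "[\<Prod>?U * g ^ card ?U = \<Prod>?U * 1] (mod P)"
    by (simp add: cong_sym)
  moreover have "\<not> P dvd \<Prod>?U"
    using irreducible_poly_dvd_prod[OF irr fin, of "\<lambda>r. r"] unit_residues_not_dvd by blast
  ultimately show ?thesis
    using cong_mult_lcancel_irreducible[OF irr, of "\<Prod>?U"] card_unit_residues[OF irr] by metis
qed

lemma poly_fermat':
  fixes P :: "'a::finite_field poly"
  assumes "irreducible P"
  shows "[g ^ (CARD('a) ^ degree P) = g] (mod P)"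
proof -
  let ?Q = "CARD('a) ^ degree P"
  have Q: "g ^ ?Q = g * g ^ (?Q - 1)"
    using power_minus_mult[of ?Q g] by (simp add: mult.commute)
  show ?thesis
  proof (cases "P dvd g")
    case True
    then show ?thesis by (simp add: Q cong_iff_dvd_diff)
  next
    case False
    then show ?thesis
      using cong_scalar_left[OF poly_fermat[OF assms False], of g] by (simp only: Q mult_1_right)
  qed
qed

section \<open>Wilson's theorem and Euler's criterion\<close>

text \<open>
Wilson's theorem and Euler's criterion both come from pairing each residue \<open>x\<close> with \<open>h / x\<close>. Each
pair contributes the factor \<open>h\<close> to the product of all residues.
\<close>

lemma prod_involution_cong:
  fixes h m :: "'b::unique_euclidean_semiring"
  assumes "finite S"
    and "\<And>x. x \<in> S \<Longrightarrow> f x \<in> S" and "\<And>x. x \<in> S \<Longrightarrow> f (f x) = x"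
    and "\<And>x. x \<in> S \<Longrightarrow> f x \<noteq> x" and "\<And>x. x \<in> S \<Longrightarrow> [x * f x = h] (mod m)"
  shows "even (card S) \<and> [\<Prod>S = h ^ (card S div 2)] (mod m)"
  using assms
proof (induction S rule: finite_psubset_induct)
  case (psubset S)
  show ?case
  proof (cases "S = {}")
    case False
    then obtain x where x: "x \<in> S" by blast
    define T where "T = S - {x, f x}"
    have fT: "f y \<in> T" if "y \<in> T" for y
      using that psubset.prems(1,2) x unfolding T_def by (metis Diff_iff insert_iff singletonD)
    have fx: "f x \<in> S" "f x \<noteq> x" using x psubset.prems by auto
    have T: "T \<subset> S" "finite T" using x psubset.hyps by (auto simp: T_def)
    have "even (card T) \<and> [\<Prod>T = h ^ (card T div 2)] (mod m)"
      by (rule psubset.IH[OF T(1)]) (use fT psubset.prems in \<open>auto simp: T_def\<close>)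
    moreover have S: "S = insert x (insert (f x) T)" "x \<notin> insert (f x) T" "f x \<notin> T"
      using x fx by (auto simp: T_def)
    have "card S = card T + 2"
      using S(2,3) T(2) by (subst S(1)) simp
    moreover have "\<Prod>S = (x * f x) * \<Prod>T"
      using S(2,3) T(2) by (subst S(1)) (simp add: mult.assoc)
    ultimately show ?thesis
      using cong_mult[OF psubset.prems(4)[OF x], of "\<Prod>T" "h ^ (card T div 2)"] by simp
  qed simp
qed

text \<open>
The involution is \<open>x \<mapsto> h / x\<close>, where the inverse of \<open>x\<close> is the power of \<open>x\<close> that Fermat's theorem
supplies.
\<close>

lemma unit_residues_involution:
  fixes P h :: "'a::finite_field poly"
  assumes irr: "irreducible P" and h: "\<not> P dvd h"
  obtains f where "\<And>x. x \<in> unit_residues P \<Longrightarrow> f x \<in> unit_residues P"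
    and "\<And>x. x \<in> unit_residues P \<Longrightarrow> f (f x) = x"
    and "\<And>x. x \<in> unit_residues P \<Longrightarrow> [x * f x = h] (mod P)"
proof -
  let ?U = "unit_residues P" and ?n = "CARD('a) ^ degree P - 1"
  have "?n > 0"
    by (rule card_unit_residues_pos[OF irr])
  \<comment> \<open>Written as \<open>?n - 1\<close>, so that one further factor \<open>x\<close> gives the Fermat exponent \<open>?n\<close>.\<close>
  define f where "f x = (h * x ^ (?n - 1)) mod P" for x
  have in_U: "f x \<in> ?U" if "x \<in> ?U" for x
    unfolding f_def using h unit_residues_not_dvd[OF that]
    by (intro mod_in_unit_residues[OF irr])
      (auto simp: irreducible_poly_dvd_mult_iff[OF irr] dest: irreducible_poly_dvd_power[OF irr])
  have cong: "[x * f x = h] (mod P)" if "x \<in> ?U" for x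
  proof -
    have "[x * f x = x * (h * x ^ (?n - 1))] (mod P)"
      unfolding f_def by (intro cong_mult) auto
    also have "x * (h * x ^ (?n - 1)) = h * x ^ ?n"
      using power_minus_mult[OF \<open>?n > 0\<close>, of x] by (simp only: ac_simps)
    also have "[h * x ^ ?n = h * 1] (mod P)"
      by (intro cong_mult poly_fermat irr cong_refl unit_residues_not_dvd[OF that])
    finally show ?thesis by simp
  qed
  have "f (f x) = x" if "x \<in> ?U" for x
  proof -
    have "[f x * f (f x) = h] (mod P)" "[f x * x = h] (mod P)"
      using cong[OF in_U[OF that]] cong[OF that] by (simp_all add: mult.commute)
    then have "[f x * f (f x) = f x * x] (mod P)"
      using cong_trans cong_sym by blast
    then have "[f (f x) = x] (mod P)"
      by (simp add: cong_mult_lcancel_irreducible[OF irr unit_residues_not_dvd[OF in_U[OF that]]])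
    then show ?thesis
      by (rule unit_residues_cong_imp_eq) (use that in_U in auto)
  qed
  with that in_U cong show ?thesis by blast
qed

text \<open>
Under \<open>x \<mapsto> 1 / x\<close> only \<open>1\<close> and \<open>- 1\<close> are fixed; the remaining residues cancel in pairs.
\<close>

lemma poly_wilson:
  fixes P :: "'a::finite_field poly"
  assumes irr: "irreducible P" and char: "CHAR('a) \<noteq> 2"
  shows "[\<Prod>(unit_residues P) = - 1] (mod P)"
proof -
  let ?U = "unit_residues P"
  have one: "\<not> P dvd 1" using irr by (simp add: irreducible_def)
  obtain f where f: "\<And>x. x \<in> ?U \<Longrightarrow> f x \<in> ?U" "\<And>x. x \<in> ?U \<Longrightarrow> f (f x) = x"
    "\<And>x. x \<in> ?U \<Longrightarrow> [x * f x = 1] (mod P)"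
    using unit_residues_involution[OF irr one] by metis
  have units: "1 \<in> ?U" "- 1 \<in> ?U"
    using irreducible_poly_degree_pos[OF irr] by (auto simp: unit_residues_def)
  have distinct: "(1 :: 'a poly) \<noteq> - 1"
    using poly_two_not_dvd[OF irr char] by (metis dvd_0_right eq_neg_iff_add_eq_0 one_add_one)
  have fixed: "x = 1 \<or> x = - 1" if "x \<in> ?U" "f x = x" for x
  proof -
    have "P dvd (x - 1) * (x - (- 1))"
      using f(3)[OF that(1)] that(2) by (simp add: cong_iff_dvd_diff algebra_simps)
    then have "[x = 1] (mod P) \<or> [x = - 1] (mod P)"
      by (simp only: irreducible_poly_dvd_mult_iff[OF irr] cong_iff_dvd_diff)
    then show ?thesis
      using unit_residues_cong_imp_eq that(1) units by blast
  qed
  have self: "f x = x" if "x = 1 \<or> x = - 1" for x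
  proof -
    have x: "x \<in> ?U" "x * x = 1" using that units by auto
    then have "[x * f x = x * x] (mod P)" using f(3) by simp
    then have "[f x = x] (mod P)"
      by (simp add: cong_mult_lcancel_irreducible[OF irr unit_residues_not_dvd[OF x(1)]])
    then show ?thesis using unit_residues_cong_imp_eq f(1) x(1) by blast
  qed
  let ?S = "?U - {1, - 1}"
  have "[\<Prod>?S = 1 ^ (card ?S div 2)] (mod P)"
  proof (rule conjunct2[OF prod_involution_cong])
    show "f x \<in> ?S" if "x \<in> ?S" for x
      using that f(1,2) self by (metis Diff_iff insert_iff singletonD)
  qed (use f fixed finite_unit_residues[OF irr] in auto)
  then have "[- 1 * \<Prod>?S = - 1 * 1] (mod P)"
    by (intro cong_mult) auto
  moreover have "\<Prod>?U = - 1 * \<Prod>?S"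
  proof -
    have U: "?U = insert 1 (insert (- 1) ?S)" using units by auto
    show ?thesis
      by (subst U) (use finite_unit_residues[OF irr] distinct in simp)
  qed
  ultimately show ?thesis by simp
qed

text \<open>
If \<open>h\<close> is a nonresidue, then \<open>x \<mapsto> h / x\<close> has no fixed point at all, since one would be a square
root of \<open>h\<close>. Hence the product of all residues is a power of \<open>h\<close>, and by Wilson's theorem it is
also \<open>- 1\<close>.
\<close>

lemma poly_euler_criterion_nonresidue:
  fixes P h :: "'a::finite_field poly"
  assumes irr: "irreducible P" and char: "CHAR('a) \<noteq> 2"
    and nonres: "\<not> poly_QuadRes P h"
  shows "[h ^ ((CARD('a) ^ degree P - 1) div 2) = - 1] (mod P)"
proof -
  let ?U = "unit_residues P"
  have "\<not> P dvd h"
  proof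
    assume "P dvd h"
    then have "[0\<^sup>2 = h] (mod P)" by (simp add: cong_iff_dvd_diff)
    with nonres show False by (auto simp: poly_QuadRes_def simp del: power_zero_numeral)
  qed
  then obtain f where f: "\<And>x. x \<in> ?U \<Longrightarrow> f x \<in> ?U" "\<And>x. x \<in> ?U \<Longrightarrow> f (f x) = x"
    "\<And>x. x \<in> ?U \<Longrightarrow> [x * f x = h] (mod P)"
    using unit_residues_involution[OF irr] by metis
  have "f x \<noteq> x" if "x \<in> ?U" for x
    using f(3)[OF that] nonres by (auto simp: poly_QuadRes_def power2_eq_square)
  then have "[\<Prod>?U = h ^ (card ?U div 2)] (mod P)"
    using prod_involution_cong[of ?U f h P] f finite_unit_residues[OF irr] by blast
  then show ?thesis
    using poly_wilson[OF irr char] cong_sym cong_trans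
    by (metis card_unit_residues[OF irr])
qed

section \<open>Divisibility by the rank, the period and the order\<close>

lemma gen_fib_add:
  "gen_fib a b (m + Suc n) = gen_fib a b (Suc m) * gen_fib a b (Suc n) + b * gen_fib a b m * gen_fib a b n"
proof (induction n rule: less_induct)
  case (less n)
  consider "n = 0" | "n = 1" | k where "n = Suc (Suc k)"
    by (metis One_nat_def not0_implies_Suc)
  then show ?case
  proof cases
    case 3
    have "gen_fib a b (m + Suc n) = a * gen_fib a b (m + Suc (Suc k)) + b * gen_fib a b (m + Suc k)"
      by (simp add: 3)
    also have "\<dots> = a * (gen_fib a b (Suc m) * gen_fib a b (Suc (Suc k)) + b * gen_fib a b m * gen_fib a b (Suc k))
        + b * (gen_fib a b (Suc m) * gen_fib a b (Suc k) + b * gen_fib a b m * gen_fib a b k)"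
      using less.IH[of k] less.IH[of "Suc k"] by (simp only: 3 lessI less_SucI)
    also have "\<dots> = gen_fib a b (Suc m) * (a * gen_fib a b (Suc (Suc k)) + b * gen_fib a b (Suc k))
        + b * gen_fib a b m * (a * gen_fib a b (Suc k) + b * gen_fib a b k)"
      by (simp only: algebra_simps)
    finally show ?thesis
      by (simp only: 3 gen_fib.simps)
  qed (simp_all add: algebra_simps)
qed

text \<open>
Past an index \<open>m\<close> with \<open>F\<^sub>m \<equiv> 0\<close> the sequence restarts, scaled by the factor \<open>F\<^bsub>m+1\<^esub>\<close>. So it is
this factor that decides by how much the period exceeds the rank.
\<close>

lemma gen_fib_shift_cong:
  assumes "[gen_fib a b m = 0] (mod P)"
  shows "[gen_fib a b (m + k) = gen_fib a b (m + 1) * gen_fib a b k] (mod P)"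
proof (cases k)
  case (Suc n)
  have "gen_fib a b (m + k) - gen_fib a b (m + 1) * gen_fib a b k = gen_fib a b m * (b * gen_fib a b n)"
    unfolding Suc gen_fib_add by simp
  then show ?thesis
    using assms by (simp add: cong_iff_dvd_diff)
qed (use assms in simp)

lemma gen_fib_zero_multiple_cong:
  assumes "[gen_fib a b m = 0] (mod P)"
  shows "[gen_fib a b (m * k) = 0] (mod P)"
    and "[gen_fib a b (m * k + 1) = gen_fib a b (m + 1) ^ k] (mod P)"
proof -
  have shift: "[gen_fib a b (m + i) = gen_fib a b (m + 1) * x] (mod P)"
    if "[gen_fib a b i = x] (mod P)" for i x
    using gen_fib_shift_cong[OF assms] cong_scalar_left[OF that] cong_trans by blast
  show "[gen_fib a b (m * k) = 0] (mod P)"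
    by (induction k) (use shift in fastforce)+
  show "[gen_fib a b (m * k + 1) = gen_fib a b (m + 1) ^ k] (mod P)"
  proof (induction k)
    case (Suc k)
    from shift[OF this] show ?case by (simp add: add_ac)
  qed simp
qed

text \<open>
Since \<open>b\<close> is invertible, the recurrence can be run backwards: two consecutive zeros would force all
earlier terms to vanish, contradicting \<open>F\<^sub>1 = 1\<close>.
\<close>

lemma gen_fib_consecutive_not_dvd:
  assumes "irreducible P" and "\<not> P dvd b" and "P dvd gen_fib a b m"
  shows "\<not> P dvd gen_fib a b (m + 1)"
  using assms(3)
proof (induction m)
  case 0
  then show ?case using assms(1) by (simp add: irreducible_def)
next
  case (Suc m)
  show ?case
  proof
    assume "P dvd gen_fib a b (Suc m + 1)"
    then have "P dvd b * gen_fib a b m"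
      using Suc.prems by (simp add: dvd_add_right_iff)
    then have "P dvd gen_fib a b m"
      using assms(1,2) by (simp add: irreducible_poly_dvd_mult_iff)
    with Suc show False by simp
  qed
qed

lemma fib_rank_dvd:
  assumes "irreducible P" and "\<not> P dvd b" and "[gen_fib a b n = 0] (mod P)"
  shows "fib_rank a b P dvd n"
  unfolding fib_rank_def
proof (rule least_positive_period_dvd)
  fix m k
  assume m: "[gen_fib a b m = 0] (mod P)"
  have "[gen_fib a b (m + k) = 0] (mod P) \<longleftrightarrow> [gen_fib a b (m + 1) * gen_fib a b k = 0] (mod P)"
    using gen_fib_shift_cong[OF m] cong_trans cong_sym by blast
  also have "\<dots> \<longleftrightarrow> [gen_fib a b k = 0] (mod P)"
    using gen_fib_consecutive_not_dvd[OF assms(1,2)] m assms(1)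
    by (simp add: cong_0_iff irreducible_poly_dvd_mult_iff)
  finally show "[gen_fib a b (m + k) = 0] (mod P) \<longleftrightarrow> [gen_fib a b k = 0] (mod P)" .
qed (use assms in simp)

lemma fib_period_dvd:
  assumes "[gen_fib a b n = 0] (mod P)" and "[gen_fib a b (n + 1) = 1] (mod P)"
  shows "fib_period a b P dvd n"
  unfolding fib_period_def
proof (rule least_positive_period_dvd)
  fix m k
  assume m: "[gen_fib a b m = 0] (mod P) \<and> [gen_fib a b (m + 1) = 1] (mod P)"
  have "[gen_fib a b (m + i) = gen_fib a b i] (mod P)" for i
  proof -
    have "[gen_fib a b (m + i) = gen_fib a b (m + 1) * gen_fib a b i] (mod P)"
      by (rule gen_fib_shift_cong[OF conjunct1[OF m]])
    also have "[gen_fib a b (m + 1) * gen_fib a b i = 1 * gen_fib a b i] (mod P)"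
      by (rule cong_scalar_right[OF conjunct2[OF m]])
    finally show ?thesis by simp
  qed
  from this[of k] this[of "k + 1"]
  show "[gen_fib a b (m + k) = 0] (mod P) \<and> [gen_fib a b (m + k + 1) = 1] (mod P) \<longleftrightarrow>
      [gen_fib a b k = 0] (mod P) \<and> [gen_fib a b (k + 1) = 1] (mod P)"
    by (simp add: cong_def)
qed (use assms in simp)

lemma
  fixes P g :: "'a::finite_field poly"
  assumes "irreducible P" and "\<not> P dvd g"
  shows poly_ord_pos: "poly_ord P g > 0"
    and poly_ord_works: "[g ^ poly_ord P g = 1] (mod P)"
proof -
  have "poly_ord P g > 0 \<and> [g ^ poly_ord P g = 1] (mod P)"
    unfolding poly_ord_def 
    using poly_fermat[OF assms] card_unit_residues_pos[OF assms(1)]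
    by (intro LeastI[of "\<lambda>n. n > 0 \<and> [g ^ n = 1] (mod P)" "CARD('a) ^ degree P - 1"] conjI)
  then show "poly_ord P g > 0" "[g ^ poly_ord P g = 1] (mod P)" by auto
qed

section \<open>A double characteristic root\<close>

text \<open>
When the discriminant vanishes modulo \<open>P\<close>, the characteristic polynomial \<open>t\<^sup>2 - a t - b\<close> is
\<open>(t - r)\<^sup>2\<close>, and the Binet formula degenerates to its derivative \<open>F\<^sub>n \<equiv> n r\<^bsup>n-1\<^esup>\<close>.
\<close>

lemma gen_fib_double_root_cong:
  fixes P r :: "'a::field poly"
  assumes "a = 2 * r" and b: "[b = - r\<^sup>2] (mod P)"
  shows "[gen_fib a b (Suc n) = of_nat (Suc n) * r ^ n] (mod P)"
proof (induction n rule: less_induct)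
  case (less n)
  consider "n = 0" | "n = 1" | k where "n = Suc (Suc k)"
    by (metis One_nat_def not0_implies_Suc)
  then show ?case
  proof cases
    case 3
    have "[gen_fib a b (Suc n) = 2 * r * (of_nat (Suc (Suc k)) * r ^ Suc k)
        + - r\<^sup>2 * (of_nat (Suc k) * r ^ k)] (mod P)"
      using less.IH[of k] less.IH[of "Suc k"] b unfolding 3 gen_fib.simps assms(1)
      by (intro cong_add cong_mult) auto
    also have "2 * r * (of_nat (Suc (Suc k)) * r ^ Suc k) + - r\<^sup>2 * (of_nat (Suc k) * r ^ k)
        = of_nat (Suc n) * r ^ n"
      unfolding 3 by (simp add: power2_eq_square algebra_simps)
    finally show ?thesis .
  qed (simp_all add: assms(1))
qed

section \<open>The Frobenius identity\<close>

text \<open>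
The terms of the sequence are the coordinates of the powers of \<open>t\<close> modulo the characteristic
polynomial: \<open>t\<^bsup>n+1\<^esup> \<equiv> F\<^bsub>n+1\<^esub> t + b F\<^sub>n\<close>. Here \<open>t\<close> is the variable \<open>[:0, 1:]\<close> of polynomials whose
coefficients are themselves polynomials.
\<close>

lemma char_poly_dvd_power_diff:
  fixes a b :: "'a::field poly"
  shows "[:- b, - a, 1:] dvd [:0, 1:] ^ Suc n - [:b * gen_fib a b n, gen_fib a b (Suc n):]"
proof (induction n)
  case (Suc n)
  let ?N = "[:- b, - a, 1:]"
  have "[:0, 1:] ^ Suc (Suc n) - [:b * gen_fib a b (Suc n), gen_fib a b (Suc (Suc n)):]
      = [:0, 1:] * ([:0, 1:] ^ Suc n - [:b * gen_fib a b n, gen_fib a b (Suc n):])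
        + smult (gen_fib a b (Suc n)) ?N"
    by (simp add: algebra_simps)
  also have "?N dvd \<dots>"
    using Suc by (intro dvd_add dvd_mult dvd_smult) auto
  finally show ?case .
qed simp

text \<open>
Modulo the characteristic polynomial, \<open>2 t - a\<close> is a square root of the discriminant.
\<close>

lemma char_poly_dvd_disc_power_diff:
  fixes a b :: "'a::field poly"
  shows "[:- b, - a, 1:] dvd [:- a, 2:] ^ (2 * j) - [:fib_disc a b ^ j:]"
proof -
  have "[:- b, - a, 1:] dvd [:- a, 2:]\<^sup>2 - [:fib_disc a b:]"
  proof
    show "[:- a, 2:]\<^sup>2 - [:fib_disc a b:] = [:- b, - a, 1:] * 4"
      by (simp add: fib_disc_def power2_eq_square numeral_poly algebra_simps)
  qed
  also have "\<dots> dvd ([:- a, 2:]\<^sup>2) ^ j - [:fib_disc a b:] ^ j"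
    by (simp add: power_diff_sumr2)
  finally show ?thesis
    by (simp add: power_mult poly_const_pow)
qed

text \<open>
Raise \<open>2 t = (2 t - a) + a\<close> to the power \<open>m\<close>, which is additive in characteristic \<open>p\<close>. Modulo
\<open>t\<^sup>2 - a t - b\<close> the left side is \<open>2 (F\<^sub>m t + b F\<^bsub>m-1\<^esub>)\<close> and the right side is
\<open>\<Delta>\<^bsup>(m-1)/2\<^esup> (2 t - a) + a\<^sup>m\<close>. Both are linear in \<open>t\<close>, so their coefficients agree. The two
identities hold exactly, before any reduction modulo \<open>P\<close>.
\<close>

lemma gen_fib_CHAR_power:
  fixes a b :: "'a::field poly"
  assumes char: "prime CHAR('a)" "CHAR('a) \<noteq> 2" and m: "m = CHAR('a) ^ k"
  shows "gen_fib a b m = fib_disc a b ^ ((m - 1) div 2)"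
    and "2 * b * gen_fib a b (m - 1) = a ^ m - a * fib_disc a b ^ ((m - 1) div 2)"
proof -
  let ?N = "[:- b, - a, 1:]" and ?t = "[:0, 1:] :: 'a poly poly" and ?w = "[:- a, 2:]"
  define j where "j = (m - 1) div 2"
  let ?D = "fib_disc a b ^ j"
  have m_eq: "m = Suc (2 * j)"
    using CHAR_power_odd[OF char, of k] unfolding j_def m[symmetric] by (auto elim: oddE)
  have frob: "(2 :: 'a poly poly) ^ m = 2" "(x + y) ^ m = x ^ m + y ^ m" for x y :: "'a poly poly"
    using two_power_CHAR_power[where ?'a = "'a poly poly"] freshmans_dream'[of m k x y] char(1) m
    by simp_all
  have "2 * ?t ^ m = (2 * ?t) ^ m"
    by (simp only: power_mult_distrib frob)
  also have "2 * ?t = ?w + [:a:]"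
    by (simp add: numeral_poly)
  also have "(?w + [:a:]) ^ m = ?w ^ m + [:a ^ m:]"
    by (simp only: frob poly_const_pow)
  finally have t_w: "2 * ?t ^ m = ?w ^ m + [:a ^ m:]" .
  let ?L = "[:2 * b * gen_fib a b (2 * j) - (a ^ m - a * ?D), 2 * gen_fib a b m - 2 * ?D:]"
  have "?N dvd ?w * (?w ^ (2 * j) - [:?D:]) - 2 * (?t ^ m - [:b * gen_fib a b (2 * j), gen_fib a b m:])"
    unfolding m_eq
    by (rule dvd_diff[OF dvd_mult[OF char_poly_dvd_disc_power_diff]
          dvd_mult[OF char_poly_dvd_power_diff]])
  also have "\<dots> = ?w ^ m - ?w * [:?D:] - 2 * ?t ^ m + 2 * [:b * gen_fib a b (2 * j), gen_fib a b m:]"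
    unfolding m_eq power_Suc by (simp only: algebra_simps)
  also have "\<dots> = ?L"
    unfolding t_w by (simp add: numeral_poly algebra_simps)
  finally have "?N dvd ?L" .
  moreover have "degree ?L < degree ?N"
    by (auto simp: degree_pCons_eq_if)
  ultimately have L: "?L = 0"
    using dvd_imp_degree_le leD by blast
  have "of_nat 2 \<noteq> (0 :: 'a poly)"
    unfolding of_nat_eq_0_iff_char_dvd
    using char primes_dvd_imp_eq[OF char(1) two_is_prime_nat] by auto
  then have "(2 :: 'a poly) \<noteq> 0" by simp
  with L show "gen_fib a b m = fib_disc a b ^ ((m - 1) div 2)"
    "2 * b * gen_fib a b (m - 1) = a ^ m - a * fib_disc a b ^ ((m - 1) div 2)"
    by (auto simp: j_def[symmetric] m_eq)
qed

section \<open>Rank and period\<close>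

text \<open>
Around the index \<open>q\<^sup>d\<close>, the size of the residue field, the sequence modulo \<open>P\<close> depends on the
discriminant only through its quadratic character, whose value is passed as \<open>e\<close>.
\<close>

lemma gen_fib_at_field_size_cong:
  fixes a b P e :: "'a::finite_field poly"
  assumes irr: "irreducible P" and char: "CHAR('a) \<noteq> 2" and card: "CARD('a) = CHAR('a) ^ l"
    and e: "[fib_disc a b ^ ((CARD('a) ^ degree P - 1) div 2) = e] (mod P)"
  shows "[gen_fib a b (CARD('a) ^ degree P) = e] (mod P)"
    and "[2 * b * gen_fib a b (CARD('a) ^ degree P - 1) = a - a * e] (mod P)"
proof -
  have "CARD('a) ^ degree P = CHAR('a) ^ (l * degree P)"
    by (subst card) (simp add: power_mult)
  note fib = gen_fib_CHAR_power[OF CHAR_prime char this, where a = a and b = b]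
  show "[gen_fib a b (CARD('a) ^ degree P) = e] (mod P)"
    unfolding fib by (rule e)
  show "[2 * b * gen_fib a b (CARD('a) ^ degree P - 1) = a - a * e] (mod P)"
    using cong_diff[OF poly_fermat'[OF irr, of a] cong_scalar_left[OF e, of a]]
    by (simp only: fib(2))
qed

text \<open>
With quadratic character \<open>1\<close> one gets \<open>F\<^sub>Q \<equiv> 1\<close> and \<open>F\<^bsub>Q-1\<^esub> \<equiv> 0\<close>.
\<close>

lemma fib_rank_period_disc_residue:
  fixes a b P :: "'a::finite_field poly"
  assumes irr: "irreducible P" and b: "\<not> P dvd b"
    and char: "CHAR('a) \<noteq> 2" and card: "CARD('a) = CHAR('a) ^ l"
    and unit: "\<not> P dvd fib_disc a b" and res: "poly_QuadRes P (fib_disc a b)"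
  shows "fib_rank a b P dvd CARD('a) ^ degree P - 1"
    and "fib_period a b P dvd CARD('a) ^ degree P - 1"
proof -
  define Q where "Q = CARD('a) ^ degree P"
  have "odd Q"
    unfolding Q_def card power_mult[symmetric] using char by (intro CHAR_power_odd) auto
  obtain y where y: "[y\<^sup>2 = fib_disc a b] (mod P)"
    using res by (auto simp: poly_QuadRes_def)
  with unit have "\<not> P dvd y"
    by (metis cong_dvd_iff dvd_power pos2 dvd_trans)
  have "[fib_disc a b ^ ((Q - 1) div 2) = (y\<^sup>2) ^ ((Q - 1) div 2)] (mod P)"
    by (intro cong_pow cong_sym[OF y])
  also have "(y\<^sup>2) ^ ((Q - 1) div 2) = y ^ (Q - 1)"
    using \<open>odd Q\<close> by (simp flip: power_mult)
  also have "[y ^ (Q - 1) = 1] (mod P)"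
    unfolding Q_def using irr \<open>\<not> P dvd y\<close> by (rule poly_fermat)
  finally have fib: "[gen_fib a b Q = 1] (mod P)" "[2 * b * gen_fib a b (Q - 1) = a - a * 1] (mod P)"
    using gen_fib_at_field_size_cong[OF irr char card] unfolding Q_def by blast+
  then have zero: "[gen_fib a b (Q - 1) = 0] (mod P)"
    using poly_two_not_dvd[OF irr char] b
    by (simp add: cong_0_iff irreducible_poly_dvd_mult_iff[OF irr])
  show "fib_rank a b P dvd CARD('a) ^ degree P - 1"
    using fib_rank_dvd[OF irr b zero] by (simp only: Q_def)
  show "fib_period a b P dvd CARD('a) ^ degree P - 1"
    using fib_period_dvd[OF zero] fib(1) \<open>odd Q\<close> by (simp add: Q_def odd_pos)
qed

text \<open>
With quadratic character \<open>- 1\<close> one gets \<open>F\<^sub>Q \<equiv> - 1\<close> and \<open>b F\<^bsub>Q-1\<^esub> \<equiv> a\<close>, so the recurrence yields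
\<open>F\<^bsub>Q+1\<^esub> \<equiv> 0\<close> and \<open>F\<^bsub>Q+2\<^esub> \<equiv> - b\<close>. The sequence restarts at \<open>Q + 1\<close> with the factor \<open>- b\<close>, hence it is
periodic after as many such restarts as the order of \<open>- b\<close>.
\<close>

lemma fib_rank_period_disc_nonresidue:
  fixes a b P :: "'a::finite_field poly"
  assumes irr: "irreducible P" and b: "\<not> P dvd b"
    and char: "CHAR('a) \<noteq> 2" and card: "CARD('a) = CHAR('a) ^ l"
    and nonres: "\<not> poly_QuadRes P (fib_disc a b)"
  shows "fib_rank a b P dvd CARD('a) ^ degree P + 1"
    and "fib_period a b P dvd (CARD('a) ^ degree P + 1) * poly_ord P (- b)"
proof -
  define Q where "Q = CARD('a) ^ degree P"
  have "Q > 0" by (simp add: Q_def)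
  then obtain n where n: "Q = Suc n" by (cases Q) auto
  note fib = gen_fib_at_field_size_cong[OF irr char card
      poly_euler_criterion_nonresidue[OF irr char nonres], folded Q_def]
  have "P dvd 2 * (b * gen_fib a b n - a)"
    using fib(2) by (simp add: n cong_iff_dvd_diff algebra_simps)
  then have "[b * gen_fib a b n = a] (mod P)"
    using poly_two_not_dvd[OF irr char]
    by (simp only: irreducible_poly_dvd_mult_iff[OF irr] cong_iff_dvd_diff simp_thms)
  then have "[a * gen_fib a b Q + b * gen_fib a b n = a * - 1 + a] (mod P)"
    by (intro cong_add cong_scalar_left fib(1))
  then have zero: "[gen_fib a b (Q + 1) = 0] (mod P)"
    by (simp add: n)
  have "[gen_fib a b (Q + 1 + 1) = a * 0 + b * - 1] (mod P)"
    using cong_add[OF cong_scalar_left[OF zero, of a] cong_scalar_left[OF fib(1), of b]] by simp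
  then have nxt: "[gen_fib a b (Q + 1 + 1) = - b] (mod P)"
    by simp
  show "fib_rank a b P dvd CARD('a) ^ degree P + 1"
    using fib_rank_dvd[OF irr b zero] by (simp only: Q_def)
  let ?o = "poly_ord P (- b)"
  have "[gen_fib a b ((Q + 1) * ?o + 1) = gen_fib a b (Q + 1 + 1) ^ ?o] (mod P)"
    by (rule gen_fib_zero_multiple_cong[OF zero])
  also have "[gen_fib a b (Q + 1 + 1) ^ ?o = (- b) ^ ?o] (mod P)"
    by (rule cong_pow[OF nxt])
  also have "[(- b) ^ ?o = 1] (mod P)"
    using b by (intro poly_ord_works irr) simp
  finally show "fib_period a b P dvd (CARD('a) ^ degree P + 1) * ?o"
    unfolding Q_def[symmetric]
    by (intro fib_period_dvd gen_fib_zero_multiple_cong[OF zero])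
qed

text \<open>
By the formula \<open>F\<^sub>n \<equiv> n r\<^bsup>n-1\<^esup>\<close> with \<open>r = a / 2\<close> invertible, \<open>F\<^sub>n\<close> vanishes exactly at the multiples
of \<open>p\<close>, and \<open>F\<^bsub>pk+1\<^esub> \<equiv> r\<^bsup>pk\<^esup>\<close>, which is \<open>1\<close> exactly when \<open>r\<^sup>k \<equiv> 1\<close>, by injectivity of the
Frobenius map.
\<close>

lemma fib_rank_period_disc_zero:
  fixes a b P :: "'a::finite_field poly"
  assumes irr: "irreducible P" and b: "\<not> P dvd b" and char: "CHAR('a) \<noteq> 2"
    and disc: "[fib_disc a b = 0] (mod P)"
  shows "fib_rank a b P = CHAR('a)"
    and "fib_period a b P = CHAR('a) * poly_ord P (smult (inverse 2) a)"
proof -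
  let ?p = "CHAR('a)"
  define r where "r = smult (inverse 2) a"
  have two: "\<not> P dvd 2"
    by (rule poly_two_not_dvd[OF irr char])
  then have "(2 :: 'a) \<noteq> 0"
    by (metis dvd_0_right numeral_poly pCons_0_0)
  then have a: "a = 2 * r"
    by (simp add: r_def numeral_poly)
  \<comment> \<open>The discriminant is \<open>4 r\<^sup>2 + 4 b\<close>; the two factors \<open>2\<close> are cancelled one at a time.\<close>
  have "P dvd 2 * (2 * (b - (- r\<^sup>2)))"
    using disc by (simp add: a fib_disc_def cong_0_iff power2_eq_square algebra_simps)
  then have b_r: "[b = - r\<^sup>2] (mod P)"
    using two by (simp only: irreducible_poly_dvd_mult_iff[OF irr] cong_iff_dvd_diff) simp
  then have r: "\<not> P dvd r"
    using b by (metis cong_dvd_iff dvd_minus_iff dvd_mult power2_eq_square)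
  have fib: "[gen_fib a b (Suc n) = of_nat (Suc n) * r ^ n] (mod P)" for n
    by (rule gen_fib_double_root_cong[OF a b_r])
  have zero_iff: "[gen_fib a b n = 0] (mod P) \<longleftrightarrow> ?p dvd n" for n
  proof (cases n)
    case (Suc k)
    have "[gen_fib a b n = 0] (mod P) \<longleftrightarrow> P dvd of_nat n * r ^ k"
      using cong_dvd_iff[OF fib[of k]] by (simp only: cong_0_iff Suc)
    also have "\<dots> \<longleftrightarrow> ?p dvd n"
      using r irreducible_poly_dvd_power[OF irr]
      by (auto simp: irreducible_poly_dvd_mult_iff[OF irr] poly_of_nat_dvd_iff[OF irr])
    finally show ?thesis .
  qed simp
  have one_iff: "[gen_fib a b (n + 1) = 1] (mod P) \<longleftrightarrow> [r ^ (n div ?p) = 1] (mod P)"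
    if "?p dvd n" for n
  proof -
    have "(of_nat n :: 'a poly) = 0"
      using that by (simp add: of_nat_eq_0_iff_char_dvd)
    then have "[gen_fib a b (n + 1) = r ^ n] (mod P)"
      using fib[of n] by simp
    then have "[gen_fib a b (n + 1) = 1] (mod P) \<longleftrightarrow> [r ^ n = 1] (mod P)"
      using cong_trans cong_sym by blast
    also have "r ^ n = (r ^ (n div ?p)) ^ ?p"
      using that by (simp flip: power_mult)
    also have "[\<dots> = 1] (mod P) \<longleftrightarrow> [r ^ (n div ?p) = 1] (mod P)"
      by (intro cong_one_power_CHAR_iff irr CHAR_prime)
    finally show ?thesis .
  qed
  show "fib_rank a b P = ?p"
    unfolding fib_rank_def zero_iff by (rule Least_equality) (auto dest: dvd_imp_le)
  have "fib_period a b P = (LEAST n. n > 0 \<and> ?p dvd n \<and> [r ^ (n div ?p) = 1] (mod P))"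
    unfolding fib_period_def zero_iff using one_iff by metis
  also have "\<dots> = ?p * poly_ord P r"
    unfolding poly_ord_def
    by (rule LEAST_positive_multiple[of _ "poly_ord P r"])
      (use poly_ord_pos[OF irr r] poly_ord_works[OF irr r] in auto)
  finally show "fib_period a b P = ?p * poly_ord P (smult (inverse 2) a)"
    by (simp only: r_def)
qed

theorem theorem5p1:
  fixes p l q d :: nat
    and a b P :: "'a::finite_field poly"
  assumes "prime p" and "odd p" and "l \<ge> 1"
    and "q = p ^ l" and "CARD('a) = q"
    and "b \<noteq> 0"
    and "irreducible P" and "coprime b P"
    and "d = degree P"
  shows "(\<not> [fib_disc a b = 0] (mod P) \<and> poly_QuadRes P (fib_disc a b) \<longrightarrow>
            fib_rank a b P dvd q ^ d - 1 \<and> fib_period a b P dvd q ^ d - 1) \<and>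
         (\<not> poly_QuadRes P (fib_disc a b) \<longrightarrow>
            fib_rank a b P dvd q ^ d + 1 \<and>
            fib_period a b P dvd (q ^ d + 1) * poly_ord P (- b)) \<and>
         ([fib_disc a b = 0] (mod P) \<longrightarrow>
            fib_rank a b P = p \<and>
            fib_period a b P = p * poly_ord P (smult (inverse 2) a))"
proof -
  note irr = \<open>irreducible P\<close>
  have b: "\<not> P dvd b"
    using irr \<open>coprime b P\<close> by (rule coprime_irreducible_not_dvd)
  have p: "CHAR('a) = p"
    using assms by (intro CHAR_eq_of_CARD_prime_power) auto
  then have char: "CHAR('a) \<noteq> 2" and card: "CARD('a) = CHAR('a) ^ l"
    using assms by auto
  have qd: "q ^ d = CARD('a) ^ degree P"
    using assms by simp
  show ?thesis
    using fib_rank_period_disc_residue[OF irr b char card]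
      fib_rank_period_disc_nonresidue[OF irr b char card]
      fib_rank_period_disc_zero[OF irr b char]
    unfolding qd p cong_0_iff by blast
qed

end
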